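(* Let $m,s\ge1$ be integers. Let $\{A_x\}_{x\in(0,\infty)}$ be finite sets with $A_x\subseteq A_y$ for $x\le y$ and with $A=\bigcup_x A_x$ infinite, let $n:A\to\mathbb N$ be a function, and for integers $\delta\ge1$ put $\pi(x,\delta)=\#\{a\in A_x: n(a)\equiv0 \pmod\delta\}$. Let $\psi:\mathbb N\to\mathbb R_{>0}$ be a function for which there exists a function $\mathcal G:\mathbb N\to\mathbb R_{>0}$ such that conditions (U2-1), (U2-2), (U2-3), (U2-4) of the context hold. Assume: (U1) for some $\beta>0$, $|n(a)|<x^\beta$ for all $x>0$ and all $a\in A_x$; (U2) there exists $c_0\in(0,1)$ such that $\pi(x,\delta)\ll \frac{1}{\psi(\delta)}\#A_x$ whenever $1\le\delta\le x^{c_0}$ (implied constant independent of $x,\delta$). Then $$\sum_{a\in A_x}d(n(a))^m\ll \#A_x\,(\log x)^{s(2^m-1)}$$ for all sufficiently large $x$.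
   Context: $d(n)$ is the number of positive divisors of $n$. $S(X,Z)$ denotes the set of positive integers $\delta\le X$ all of whose prime factors are $\le Z$. In all sums $d_1,\dots,d_m$ run over positive integers. Implied constants are uniform in $x$ and $u$. The conditions on $\psi$ and $\mathcal G$ are: (U2-1) For all $x\ge2$: $\displaystyle\sum_{\substack{d_1,\dots,d_m\le x\\ \delta=\mathrm{lcm}(d_1,\dots,d_m)}}\frac1{\psi(\delta)}\ll(\log x)^{s(2^m-1)}$. (U2-2) For all $x\ge2$: $\displaystyle\sum_{\substack{d_1,\dots,d_m\le x\\ \delta=\mathrm{lcm}(d_1,\dots,d_m)}}\frac{\delta}{\psi(\delta)^2\mathcal G(\delta)}\ll(\log x)^{s(2^m-1)}$. (U2-3) Let $c\in(0,1)$ (arbitrary). For $x\ge3$, if $4/c\le u<\frac{\log x}{2\log\log x}$, then $$\sum_{\substack{d_1,\dots,d_m\in S(x^c,x^{1/u})\\ d_1,\dots,d_m\ge x^{c/4}\\ \delta=\mathrm{lcm}(d_1,\dots,d_m)}}\frac{\mathcal G(\delta)}{\delta}\ll(\log x)^{s(2^m-1)}\exp\Bigl(-\frac{cu\log u}{16}\Bigr),$$ and if $u\ge\frac{\log x}{2\log\log x}$, then the same sum is $\ll x^{-\eta}$ for some $\eta=\eta(c)>0$. (U2-4) For $\delta\ge3$: $\displaystyle\frac{\delta}{\psi(\delta)\mathcal G(\delta)}\ll(\log\log\delta)^B$ for some constant $B$. *)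

theory Defs
  imports
    Complex_Main
    "HOL-Library.FuncSet"
    "HOL-Library.Landau_Symbols"
    "HOL-Computational_Algebra.Primes"
begin

text \<open>
  A function on the positive integers is represented by a function on \<^typ>\<open>nat\<close> whose value
  at 0 is never used. Every bound \<open>F \<lless> H\<close> stated on an explicit range is rendered as the
  existence of one constant \<open>C\<close> with \<open>F \<le> C * H\<close> on the whole range; all the quantities \<open>F\<close>
  and \<open>H\<close> involved are nonnegative there.
\<close>

definition divisor_count :: "nat \<Rightarrow> nat" where
  "divisor_count k = card {t. t dvd k}"

definition smooth_numbers :: "real \<Rightarrow> real \<Rightarrow> nat set" where
  "smooth_numbers X Z =
     {\<delta>. 1 \<le> \<delta> \<and> real \<delta> \<le> X \<and> (\<forall>p. prime p \<and> p dvd \<delta> \<longrightarrow> real p \<le> Z)}"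

text \<open>
  The \<open>m\<close>-tuple \<open>d\<^sub>1, \<dots>, d\<^sub>m\<close> is an extensional function on \<open>{1..m}\<close>, so that every tuple
  is counted exactly once.
\<close>

definition lcm_sum :: "nat \<Rightarrow> nat set \<Rightarrow> (nat \<Rightarrow> real) \<Rightarrow> real" where
  "lcm_sum m D f = (\<Sum>d \<in> {1..m} \<rightarrow>\<^sub>E D. f (Lcm (d ` {1..m})))"

definition cond_U2_1 :: "nat \<Rightarrow> nat \<Rightarrow> (nat \<Rightarrow> real) \<Rightarrow> bool" where
  "cond_U2_1 m s \<psi> \<longleftrightarrow>
     (\<exists>C::real. \<forall>x::real. x \<ge> 2 \<longrightarrow>
        lcm_sum m {k. 1 \<le> k \<and> real k \<le> x} (\<lambda>\<delta>. 1 / \<psi> \<delta>)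
          \<le> C * ln x ^ (s * (2 ^ m - 1)))"

definition cond_U2_2 ::
    "nat \<Rightarrow> nat \<Rightarrow> (nat \<Rightarrow> real) \<Rightarrow> (nat \<Rightarrow> real) \<Rightarrow> bool" where
  "cond_U2_2 m s \<psi> \<G> \<longleftrightarrow>
     (\<exists>C::real. \<forall>x::real. x \<ge> 2 \<longrightarrow>
        lcm_sum m {k. 1 \<le> k \<and> real k \<le> x} (\<lambda>\<delta>. real \<delta> / ((\<psi> \<delta>)\<^sup>2 * \<G> \<delta>))
          \<le> C * ln x ^ (s * (2 ^ m - 1)))"

text \<open>
  The constants may depend on \<open>c\<close>, but not on \<open>x\<close> and \<open>u\<close>.
\<close>

definition cond_U2_3 :: "nat \<Rightarrow> nat \<Rightarrow> (nat \<Rightarrow> real) \<Rightarrow> bool" where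
  "cond_U2_3 m s \<G> \<longleftrightarrow>
     (\<forall>c::real. 0 < c \<and> c < 1 \<longrightarrow>
        (\<exists>C::real. \<forall>x u :: real.
           x \<ge> 3 \<and> 4 / c \<le> u \<and> u < ln x / (2 * ln (ln x)) \<longrightarrow>
             lcm_sum m {k \<in> smooth_numbers (x powr c) (x powr (1 / u)). x powr (c / 4) \<le> real k}
                 (\<lambda>\<delta>. \<G> \<delta> / real \<delta>)
               \<le> C * ln x ^ (s * (2 ^ m - 1)) * exp (- (c * u * ln u / 16))) \<and>
        (\<exists>\<eta>::real. \<eta> > 0 \<and> (\<exists>C::real. \<forall>x u :: real.
           x \<ge> 3 \<and> u \<ge> ln x / (2 * ln (ln x)) \<longrightarrow>
             lcm_sum m {k \<in> smooth_numbers (x powr c) (x powr (1 / u)). x powr (c / 4) \<le> real k}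
                 (\<lambda>\<delta>. \<G> \<delta> / real \<delta>)
               \<le> C * x powr (- \<eta>))))"

definition cond_U2_4 :: "(nat \<Rightarrow> real) \<Rightarrow> (nat \<Rightarrow> real) \<Rightarrow> bool" where
  "cond_U2_4 \<psi> \<G> \<longleftrightarrow>
     (\<exists>B C :: real. \<forall>\<delta>::nat. \<delta> \<ge> 3 \<longrightarrow>
        real \<delta> / (\<psi> \<delta> * \<G> \<delta>) \<le> C * ln (ln (real \<delta>)) powr B)"

definition pi_count :: "(real \<Rightarrow> 'a set) \<Rightarrow> ('a \<Rightarrow> nat) \<Rightarrow> real \<Rightarrow> nat \<Rightarrow> nat" where
  "pi_count A n x \<delta> = card {a \<in> A x. \<delta> dvd n a}"

definition cond_U1 :: "(real \<Rightarrow> 'a set) \<Rightarrow> ('a \<Rightarrow> nat) \<Rightarrow> bool" where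
  "cond_U1 A n \<longleftrightarrow>
     (\<exists>\<beta>::real. \<beta> > 0 \<and> (\<forall>x>0. \<forall>a\<in>A x. real (n a) < x powr \<beta>))"

definition cond_U2 :: "(real \<Rightarrow> 'a set) \<Rightarrow> ('a \<Rightarrow> nat) \<Rightarrow> (nat \<Rightarrow> real) \<Rightarrow> bool" where
  "cond_U2 A n \<psi> \<longleftrightarrow>
     (\<exists>c\<^sub>0::real. 0 < c\<^sub>0 \<and> c\<^sub>0 < 1 \<and>
        (\<exists>C::real. \<forall>x>0. \<forall>\<delta>::nat. 1 \<le> \<delta> \<and> real \<delta> \<le> x powr c\<^sub>0 \<longrightarrow>
           real (pi_count A n x \<delta>) \<le> C * (1 / \<psi> \<delta>) * real (card (A x))))"

end

theory Submission
  imports Defs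
begin

text \<open>
  Order the primes of \<open>n(a)\<close> increasingly (with multiplicity) and write \<open>n(a) = b D\<close>, where \<open>b\<close> is
  the longest initial product with \<open>b \<le> x powr c\<close>, \<open>c\<close> being the exponent of (U2). Let \<open>q\<close> be the
  least prime of \<open>D\<close>, so that \<open>b q > x powr c\<close> and \<open>b\<close> is \<open>q\<close>-smooth. Expanding \<open>d(b)\<^sup>m\<close> as the
  number of \<open>m\<close>-tuples of divisors of \<open>b\<close>, whose lcm divides \<open>b\<close> and hence is in the range of (U2),
  turns the divisor sum into a sum of \<open>1 / \<psi>(lcm)\<close>.

  If \<open>q \<ge> x powr (1 / u0)\<close>, then \<open>D\<close> has boundedly many prime factors and (U2-1) applies.
  Otherwise \<open>b \<ge> x powr (c / 2)\<close>, and \<open>d(b)\<close> is at most twice the number of divisors of \<open>b\<close> that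
  are at least \<open>x powr (c / 4)\<close>. If \<open>q\<close> lies between \<open>x powr (1 / (k + 1))\<close> and \<open>x powr (1 / k)\<close>, then
  \<open>d(D) \<le> 2 powr (\<beta> (k + 1))\<close>, which is beaten by the saving \<open>exp (- c k ln k / 32)\<close> obtained from
  (U2-2) and (U2-3) via Cauchy-Schwarz, since \<open>1 / \<psi>\<^sup>2 = (\<delta> / (\<psi>\<^sup>2 \<G>)) (\<G> / \<delta>)\<close>. If \<open>q \<le> (log x)\<^sup>2\<close>, the
  bound \<open>d(D) \<lless> D powr \<epsilon>\<close> is beaten by the saving \<open>x powr (- \<eta> / 2)\<close>.
\<close>

section \<open>The divisor function: submultiplicativity and upper bounds\<close>

lemma divisor_count_1 [simp]: "divisor_count (Suc 0) = 1"
  by (simp add: divisor_count_def)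

lemma divisor_count_mult_le:
  assumes "a \<ge> 1" "b \<ge> 1"
  shows "divisor_count (a * b) \<le> divisor_count a * divisor_count b"
proof -
  have fin: "finite {t. t dvd a}" "finite {t. t dvd b}"
    using assms by auto
  have "{t. t dvd a * b} \<subseteq> (\<lambda>(s, t). s * t) ` ({t. t dvd a} \<times> {t. t dvd b})"
    by (auto dest!: division_decomp)
  then have "card {t. t dvd a * b} \<le> card ({t. t dvd a} \<times> {t. t dvd b})"
    by (rule surj_card_le[rotated]) (use fin in blast)
  then show ?thesis
    by (simp add: divisor_count_def card_cartesian_product)
qed

lemma divisor_count_prime: "prime p \<Longrightarrow> divisor_count p = 2"
proof -
  assume p: "prime p"
  then have "{t. t dvd p} = {1, p}" and "p \<noteq> 1"
    by (auto simp: prime_nat_iff)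
  then show ?thesis
    by (simp add: divisor_count_def)
qed

lemma divisor_count_prime_power:
  assumes "prime p"
  shows "divisor_count (p ^ e) = e + 1"
proof -
  have "{t. t dvd p ^ e} = (\<lambda>i. p ^ i) ` {..e}"
    using assms by (auto simp: divides_primepow_nat le_imp_power_dvd)
  moreover have "inj_on (\<lambda>i. p ^ i) {..e}"
    using assms prime_gt_1_nat by (auto simp: inj_on_def)
  ultimately show ?thesis
    by (simp add: divisor_count_def card_image)
qed

text \<open>Each prime factor of \<open>D\<close>, counted with multiplicity, at most doubles the
  divisor count, and there are at most \<open>ln D / ln y\<close> of them.\<close>

lemma divisor_count_le_powr:
  assumes "D \<ge> 1" "y > 1" "\<And>p. prime p \<Longrightarrow> p dvd D \<Longrightarrow> real p \<ge> y"
  shows "real (divisor_count D) \<le> 2 powr (ln D / ln y)"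
  using assms
proof (induction D rule: less_induct)
  case (less D)
  show ?case
  proof (cases "D = 1")
    case True
    then show ?thesis by simp
  next
    case False
    then obtain p where p: "prime p" "p dvd D"
      using prime_factor_nat by blast
    then obtain D' where D': "D = p * D'" by blast
    have "D' \<ge> 1" "p \<ge> 2"
      using less.prems D' prime_ge_2_nat[OF p(1)] by (auto simp: Suc_le_eq intro: Nat.gr0I)
    then have "D' < D" using D' by simp
    have IH: "real (divisor_count D') \<le> 2 powr (ln D' / ln y)"
      by (rule less.IH) (use \<open>D' < D\<close> \<open>D' \<ge> 1\<close> less.prems D' in auto)
    have "ln y \<le> ln p"
      using less.prems(3)[OF p] less.prems(2) by simp
    then have "1 \<le> ln p / ln y"
      using less.prems(2) by simp
    have "real (divisor_count D) \<le> real (divisor_count p * divisor_count D')"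
      unfolding D' of_nat_le_iff using \<open>D' \<ge> 1\<close> \<open>p \<ge> 2\<close> by (intro divisor_count_mult_le) auto
    also have "\<dots> \<le> 2 powr 1 * 2 powr (ln D' / ln y)"
      using IH by (simp add: divisor_count_prime[OF p(1)])
    also have "\<dots> \<le> 2 powr (ln p / ln y) * 2 powr (ln D' / ln y)"
      using \<open>1 \<le> ln p / ln y\<close> by (intro mult_right_mono powr_mono) auto
    also have "\<dots> = 2 powr (ln D / ln y)"
      using \<open>D' \<ge> 1\<close> \<open>p \<ge> 2\<close> unfolding D'
      by (simp add: powr_add[symmetric] add_divide_distrib[symmetric] ln_mult)
    finally show ?thesis .
  qed
qed

lemma divisor_count_prod_le:
  assumes "finite I" "\<And>i. i \<in> I \<Longrightarrow> f i \<ge> 1"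
  shows "divisor_count (\<Prod>i\<in>I. f i) \<le> (\<Prod>i\<in>I. divisor_count (f i))"
  using assms
proof (induction I rule: finite_induct)
  case (insert i I)
  have "(\<Prod>i\<in>I. f i) \<ge> 1"
    using insert.prems by (simp add: Suc_le_eq prod_pos)
  then have "divisor_count (f i * (\<Prod>i\<in>I. f i)) \<le> divisor_count (f i) * divisor_count (\<Prod>i\<in>I. f i)"
    using insert.prems by (intro divisor_count_mult_le) auto
  also have "\<dots> \<le> divisor_count (f i) * (\<Prod>i\<in>I. divisor_count (f i))"
    using insert by (intro mult_left_mono) auto
  finally show ?case using insert by simp
qed auto

text \<open>The ratio of \<open>e + 1\<close> to \<open>(p ^ e) powr \<epsilon>\<close> is bounded
  for all prime powers, and is at most 1 once \<open>p\<close> is large; so only finitely many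
  primes contribute a factor above 1.\<close>

lemma divisor_bound:
  assumes "\<epsilon> > 0"
  obtains M where "M \<ge> 1" "\<And>D. D \<ge> 1 \<Longrightarrow> real (divisor_count D) \<le> M * real D powr \<epsilon>"
proof -
  \<comment> \<open>\<open>K\<close> comes from \<open>1 + t \<le> exp t\<close> at
    \<open>t = \<epsilon> * ln 2 * e\<close>; \<open>P\<close> is chosen so that
    \<open>p \<ge> P\<close> forces \<open>p powr \<epsilon> \<ge> 2\<close>.\<close>
  define K where "K = 1 + 1 / (\<epsilon> * ln 2)"
  define P where "P = nat \<lceil>2 powr (1 / \<epsilon>)\<rceil>"
  have "K \<ge> 1" using assms by (simp add: K_def)
  have small: "real (e + 1) \<le> K * real (p ^ e) powr \<epsilon>" if "p \<ge> 2" for p e :: nat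
  proof -
    have p1: "1 \<le> real (p ^ e) powr \<epsilon>"
      using that assms by (intro ge_one_powr_ge_zero) (simp_all add: Suc_le_eq)
    have "1 + \<epsilon> * ln 2 * e \<le> exp (\<epsilon> * ln 2 * e)"
      by (rule exp_ge_add_one_self)
    also have "\<dots> = (2 ^ e) powr \<epsilon>"
      by (simp add: powr_def ln_realpow mult_ac)
    also have "\<dots> \<le> real (p ^ e) powr \<epsilon>"
      using that assms by (intro powr_mono2) (auto intro: power_mono)
    finally have "\<epsilon> * ln 2 * e \<le> real (p ^ e) powr \<epsilon>" by simp
    then have "e \<le> 1 / (\<epsilon> * ln 2) * real (p ^ e) powr \<epsilon>"
      using assms by (simp add: field_simps)
    then show ?thesis
      using p1 by (simp add: K_def distrib_right)
  qed
  have large: "real (e + 1) \<le> real (p ^ e) powr \<epsilon>" if "p \<ge> P" for p e :: nat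
  proof -
    have "2 powr (1 / \<epsilon>) \<le> p"
      using that by (simp add: P_def nat_le_iff ceiling_le_iff)
    then have "(2 powr (1 / \<epsilon>)) powr \<epsilon> \<le> p powr \<epsilon>"
      using assms by (intro powr_mono2) auto
    then have *: "2 \<le> real p powr \<epsilon>"
      using assms by (simp add: powr_powr)
    then have "p > 0" by (auto intro: Nat.gr0I)
    have "e + 1 \<le> 2 ^ e" by (induction e) auto
    then have "real (e + 1) \<le> real (2 ^ e)" by (rule of_nat_mono)
    also have "\<dots> \<le> (real p powr \<epsilon>) ^ e"
      using * by (auto intro: power_mono)
    also have "\<dots> = real (p ^ e) powr \<epsilon>"
      using \<open>p > 0\<close> by (simp add: powr_powr mult.commute flip: powr_realpow)
    finally show ?thesis .
  qed
  show ?thesis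
  proof
    show "K ^ P \<ge> 1" using \<open>K \<ge> 1\<close> by simp
    fix D :: nat assume "D \<ge> 1"
    let ?I = "prime_factors D" and ?e = "\<lambda>p. multiplicity p D"
    have D: "D = (\<Prod>p\<in>?I. p ^ ?e p)"
      using \<open>D \<ge> 1\<close> by (simp add: prod_prime_factors)
    have pr: "prime p" if "p \<in> ?I" for p using that by auto
    have "real (divisor_count D) \<le> real (\<Prod>p\<in>?I. divisor_count (p ^ ?e p))"
      by (subst D, unfold of_nat_le_iff, rule divisor_count_prod_le)
         (use pr in \<open>auto simp: Suc_le_eq prime_gt_0_nat\<close>)
    also have "\<dots> = (\<Prod>p\<in>?I. real (?e p + 1))"
      using pr by (simp add: divisor_count_prime_power)
    \<comment> \<open>A prime below \<open>P\<close> costs one factor \<open>K\<close>, and there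
      are at most \<open>P\<close> such primes.\<close>
    also have "\<dots> \<le> (\<Prod>p\<in>?I. (if p < P then K else 1) * real (p ^ ?e p) powr \<epsilon>)"
      using small large prime_ge_2_nat[OF pr] by (intro prod_mono) (simp del: of_nat_power)
    also have "\<dots> = (\<Prod>p\<in>?I. if p < P then K else 1) * (\<Prod>p\<in>?I. real (p ^ ?e p) powr \<epsilon>)"
      by (rule prod.distrib)
    also have "(\<Prod>p\<in>?I. real (p ^ ?e p) powr \<epsilon>) = (\<Prod>p\<in>?I. real (p ^ ?e p)) powr \<epsilon>"
      by (rule prod_powr_distrib[symmetric])
    also have "\<dots> = real D powr \<epsilon>"
      by (subst (2) D) simp
    also have "(\<Prod>p\<in>?I. if p < P then K else 1) = K ^ card {p\<in>?I. p < P}"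
      by (subst prod.inter_filter[symmetric]) simp_all
    also have "\<dots> \<le> K ^ P"
    proof (rule power_increasing[OF _ \<open>K \<ge> 1\<close>])
      have "card {p\<in>?I. p < P} \<le> card {..<P}" by (intro card_mono) auto
      then show "card {p\<in>?I. p < P} \<le> P" by simp
    qed
    finally show "real (divisor_count D) \<le> K ^ P * real D powr \<epsilon>"
      by (simp add: mult_right_mono)
  qed
qed

text \<open>Of two complementary divisors \<open>t\<close> and \<open>b div t\<close>, at least one
  is no smaller than \<open>sqrt b\<close>.\<close>

lemma divisor_count_le_twice_large:
  assumes "b \<ge> 1"
  shows "divisor_count b \<le> 2 * card {t. t dvd b \<and> sqrt b \<le> real t}"
proof -
  let ?L = "{t. t dvd b \<and> sqrt b \<le> real t}"
  have fin: "finite ?L" using assms by (intro finite_subset[OF _ finite_divisors_nat[of b]]) auto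
  have "{t. t dvd b} \<subseteq> ?L \<union> (\<lambda>t. b div t) ` ?L"
  proof
    fix t assume "t \<in> {t. t dvd b}"
    then obtain r where r: "b = t * r" by blast
    then have "t > 0" "r > 0" using assms by (auto intro: Nat.gr0I)
    show "t \<in> ?L \<union> (\<lambda>t. b div t) ` ?L"
    proof (cases "sqrt b \<le> t")
      case True
      then show ?thesis using r by auto
    next
      case False
      then have "t * sqrt b \<le> sqrt b * sqrt b" by (intro mult_right_mono) auto
      also have "\<dots> = real t * real r" using r by simp
      finally have "sqrt b \<le> r" using \<open>t > 0\<close> by simp
      then have "r \<in> ?L" "t = b div r" using r \<open>r > 0\<close> by auto
      then show ?thesis by blast
    qed
  qed
  then have "card {t. t dvd b} \<le> card (?L \<union> (\<lambda>t. b div t) ` ?L)"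
    using fin by (intro card_mono) auto
  also have "\<dots> \<le> card ?L + card ((\<lambda>t. b div t) ` ?L)" by (rule card_Un_le)
  also have "\<dots> \<le> card ?L + card ?L" using card_image_le[OF fin] by simp
  finally show ?thesis by (simp add: divisor_count_def)
qed

section \<open>Splitting an integer along its increasing prime factors\<close>

text \<open>Induction by stripping off the largest prime factor \<open>P\<close>: a splitting of the
  quotient survives when \<open>P\<close> is moved into \<open>D\<close>, since \<open>P\<close> is
  too large to change which prime of \<open>D\<close> is least.\<close>

lemma prime_prefix_exists:
  fixes N :: nat and z :: real
  assumes "N \<ge> 1" "z \<ge> 1"
  shows "\<exists>b D. N = b * D \<and> real b \<le> z \<and>
    (D = 1 \<or> (\<exists>q. prime q \<and> q dvd D \<and> real b * real q > z \<and>
       (\<forall>p. prime p \<and> p dvd b \<longrightarrow> p \<le> q) \<and> (\<forall>p. prime p \<and> p dvd D \<longrightarrow> q \<le> p)))"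
  using assms(1)
proof (induction N rule: less_induct)
  case (less N)
  show ?case
  proof (cases "real N \<le> z")
    case True
    then show ?thesis by (intro exI[of _ N] exI[of _ 1]) simp
  next
    case False
    define P where "P = Max (prime_factors N)"
    have "N > 1" using False assms(2) by (cases "N > 1") (use less.prems in auto)
    then have "prime_factors N \<noteq> {}"
      using prime_factor_nat[of N] by (auto simp: prime_factors_dvd)
    then have "P \<in> prime_factors N" unfolding P_def by (intro Max_in) auto
    then have P: "prime P" "P dvd N" by auto
    have Pmax: "p \<le> P" if "prime p" "p dvd N" for p
      unfolding P_def using that less.prems by (intro Max_ge) (auto simp: prime_factors_dvd)
    obtain N' where N': "N = P * N'" using P by blast
    have "N' \<ge> 1" using N' less.prems by (auto simp: Suc_le_eq intro: Nat.gr0I)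
    then have "N' < N" using N' prime_gt_1_nat[OF P(1)] by simp
    from less.IH[OF this \<open>N' \<ge> 1\<close>] obtain b D where
      bD: "N' = b * D" "real b \<le> z" and
      alt: "D = 1 \<or> (\<exists>q. prime q \<and> q dvd D \<and> real b * real q > z \<and>
       (\<forall>p. prime p \<and> p dvd b \<longrightarrow> p \<le> q) \<and> (\<forall>p. prime p \<and> p dvd D \<longrightarrow> q \<le> p))"
      by blast
    have N: "N = b * (D * P)" using N' bD by simp
    from alt have "\<exists>q. prime q \<and> q dvd D * P \<and> real b * real q > z \<and>
       (\<forall>p. prime p \<and> p dvd b \<longrightarrow> p \<le> q) \<and> (\<forall>p. prime p \<and> p dvd D * P \<longrightarrow> q \<le> p)"
    proof
      \<comment> \<open>Here \<open>b\<close> is the whole of \<open>N'\<close>, so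
        \<open>N > z\<close> reads \<open>b * P > z\<close>, and the stripped prime is the
        witness.\<close>
      assume "D = 1"
      then show ?thesis
        using P False Pmax N by (intro exI[of _ P]) (auto dest: primes_dvd_imp_eq)
    next
      assume "\<exists>q. prime q \<and> q dvd D \<and> real b * real q > z \<and>
       (\<forall>p. prime p \<and> p dvd b \<longrightarrow> p \<le> q) \<and> (\<forall>p. prime p \<and> p dvd D \<longrightarrow> q \<le> p)"
      then obtain q where q: "prime q" "q dvd D" "real b * real q > z"
        "\<forall>p. prime p \<and> p dvd b \<longrightarrow> p \<le> q" "\<forall>p. prime p \<and> p dvd D \<longrightarrow> q \<le> p" by blast
      have "q \<le> P" using q N by (intro Pmax) auto
      then show ?thesis
        using q P by (intro exI[of _ q]) (auto simp: prime_dvd_mult_iff dest: primes_dvd_imp_eq)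
    qed
    then show ?thesis using N bD(2) by blast
  qed
qed

section \<open>Sums over tuples through their lcm\<close>

text \<open>Keeps every argument in the range where \<psi> and \<G> are known to be
  positive.\<close>

lemma Lcm_tuple_ge_1:
  fixes D :: "nat set" and m :: nat
  assumes "0 \<notin> D" "d \<in> {1..m} \<rightarrow>\<^sub>E D"
  shows "Lcm (d ` {1..m}) \<ge> 1"
proof -
  have "0 \<notin> d ` {1..m}" using assms by (metis PiE_mem imageE)
  then have "Lcm (d ` {1..m}) \<noteq> 0" by (subst Lcm_0_iff_nat) auto
  then show ?thesis by linarith
qed

lemma lcm_sum_mono:
  assumes "finite D'" "D \<subseteq> D'" "0 \<notin> D'" "\<And>\<delta>. \<delta> \<ge> 1 \<Longrightarrow> f \<delta> \<ge> 0"
  shows "lcm_sum m D f \<le> lcm_sum m D' f"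
proof -
  have "Lcm (d ` {1..m}) \<ge> 1" if "d \<in> {1..m} \<rightarrow>\<^sub>E D'" for d
    using that assms by (intro Lcm_tuple_ge_1)
  then show ?thesis
    unfolding lcm_sum_def using assms
    by (intro sum_mono2) (auto intro!: finite_PiE PiE_mono dest: PiE_mono)
qed

text \<open>AM-GM with weight \<open>r\<close>; it takes the place of the Cauchy-Schwarz inequality.\<close>

lemma lcm_sum_inverse_le:
  assumes "r > 0" "0 \<notin> D" "\<And>\<delta>. \<delta> \<ge> 1 \<Longrightarrow> \<psi> \<delta> > 0" "\<And>\<delta>. \<delta> \<ge> 1 \<Longrightarrow> \<G> \<delta> > 0"
  shows "lcm_sum m D (\<lambda>\<delta>. 1 / \<psi> \<delta>) \<le>
    (r * lcm_sum m D (\<lambda>\<delta>. real \<delta> / ((\<psi> \<delta>)\<^sup>2 * \<G> \<delta>)) + lcm_sum m D (\<lambda>\<delta>. \<G> \<delta> / real \<delta>) / r) / 2"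
proof -
  have *: "1 / \<psi> \<delta> \<le> (r * (real \<delta> / ((\<psi> \<delta>)\<^sup>2 * \<G> \<delta>)) + \<G> \<delta> / real \<delta> / r) / 2" if "\<delta> \<ge> 1" for \<delta>
  proof -
    note pos = assms(1) assms(3)[OF that] assms(4)[OF that]
    have "0 \<le> (r * \<delta> - \<psi> \<delta> * \<G> \<delta>)\<^sup>2 / (2 * r * \<delta> * (\<psi> \<delta>)\<^sup>2 * \<G> \<delta>)"
      using pos by (intro divide_nonneg_nonneg mult_nonneg_nonneg) auto
    also have "\<dots> = (r * (real \<delta> / ((\<psi> \<delta>)\<^sup>2 * \<G> \<delta>)) + \<G> \<delta> / real \<delta> / r) / 2 - 1 / \<psi> \<delta>"
      using pos that by (simp add: field_simps power2_eq_square)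
    finally show ?thesis by simp
  qed
  have "Lcm (d ` {1..m}) \<ge> 1" if "d \<in> {1..m} \<rightarrow>\<^sub>E D" for d
    using that assms by (intro Lcm_tuple_ge_1)
  then show ?thesis
    unfolding lcm_sum_def sum_distrib_left sum_divide_distrib sum.distrib[symmetric]
    by (intro sum_mono *)
qed

text \<open>The \<open>m\<close>-th power of a divisor count is a count of \<open>m\<close>-tuples,
  and all entries divide \<open>b a\<close> exactly when their lcm does. Exchanging the sums leaves,
  for each tuple, a count of multiples of its lcm.\<close>

lemma sum_card_divisors_power_le:
  fixes C X :: real
  assumes fin: "finite A" "S \<subseteq> A" "finite D" and D: "0 \<notin> D" and C: "C \<ge> 0"
    and b: "\<And>a. a \<in> S \<Longrightarrow> b a dvd n a \<and> b a \<ge> 1 \<and> real (b a) \<le> X"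
    and psi: "\<And>\<delta>. \<delta> \<ge> 1 \<Longrightarrow> \<psi> \<delta> > 0"
    and U2: "\<And>\<delta>. \<delta> \<ge> 1 \<Longrightarrow> real \<delta> \<le> X \<Longrightarrow> real (card {a\<in>A. \<delta> dvd n a}) \<le> C * (1 / \<psi> \<delta>) * card A"
  shows "(\<Sum>a\<in>S. real (card {t\<in>D. t dvd b a}) ^ m) \<le> C * card A * lcm_sum m D (\<lambda>\<delta>. 1 / \<psi> \<delta>)"
proof -
  let ?T = "{1..m} \<rightarrow>\<^sub>E D" and ?l = "\<lambda>d::nat\<Rightarrow>nat. Lcm (d ` {1..m})"
  have finT: "finite ?T" and finS: "finite S"
    using fin finite_subset by (auto intro: finite_PiE)
  have l1: "?l d \<ge> 1" if "d \<in> ?T" for d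
    using that assms by (intro Lcm_tuple_ge_1)
  have "(\<Sum>a\<in>S. real (card {t\<in>D. t dvd b a}) ^ m) = (\<Sum>a\<in>S. real (card {d\<in>?T. ?l d dvd b a}))"
  proof (rule sum.cong[OF refl])
    fix a
    have "{d\<in>?T. ?l d dvd b a} = {1..m} \<rightarrow>\<^sub>E {t\<in>D. t dvd b a}"
      by (auto simp: PiE_def Pi_def Lcm_dvd_iff)
    then show "real (card {t\<in>D. t dvd b a}) ^ m = real (card {d\<in>?T. ?l d dvd b a})"
      by (simp add: card_PiE)
  qed
  also have "\<dots> = (\<Sum>a\<in>S. \<Sum>d\<in>?T. if ?l d dvd b a then 1 else 0)"
    using finT by (simp add: sum.If_cases Int_def)
  also have "\<dots> = (\<Sum>d\<in>?T. \<Sum>a\<in>S. if ?l d dvd b a then 1 else 0)"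
    by (rule sum.swap)
  also have "\<dots> = (\<Sum>d\<in>?T. real (card {a\<in>S. ?l d dvd b a}))"
    using finS by (simp add: sum.If_cases Int_def)
  also have "\<dots> \<le> (\<Sum>d\<in>?T. C * card A * (1 / \<psi> (?l d)))"
  proof (rule sum_mono)
    fix d assume d: "d \<in> ?T"
    show "real (card {a\<in>S. ?l d dvd b a}) \<le> C * card A * (1 / \<psi> (?l d))"
    \<comment> \<open>\<open>U2\<close> requires the lcm to be at most \<open>X\<close>. A single
      \<open>a\<close> with \<open>?l d dvd b a\<close> supplies this through
      \<open>b a \<le> X\<close>; without one the left side vanishes.\<close>
    proof (cases "{a\<in>S. ?l d dvd b a} = {}")
      case True
      have "0 \<le> C * card A * (1 / \<psi> (?l d))"
        using C psi[OF l1[OF d]] by simp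
      then show ?thesis unfolding True by simp
    next
      case False
      then obtain a where a: "a \<in> S" "?l d dvd b a" by blast
      then have "?l d \<le> b a" using b by (intro dvd_imp_le) (auto simp: Suc_le_eq)
      then have "real (?l d) \<le> X" using b[OF a(1)] by linarith
      have "card {a\<in>S. ?l d dvd b a} \<le> card {a\<in>A. ?l d dvd n a}"
        using fin b by (intro card_mono) (auto intro: dvd_trans)
      then show ?thesis
        using U2[OF l1[OF d] \<open>real (?l d) \<le> X\<close>] by (simp add: mult_ac)
    qed
  qed
  finally show ?thesis by (simp add: lcm_sum_def sum_distrib_left)
qed

section \<open>A convergent series and sums over unions\<close>

lemma summable_exp_linear_minus_nlogn:
  fixes \<alpha> \<gamma> :: real
  assumes "\<gamma> > 0"
  shows "summable (\<lambda>k. exp (\<alpha> * real (k + 1) - \<gamma> * real k * ln (real k)))"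
proof (rule summable_comparison_test_ev)
  \<comment> \<open>For \<open>k \<ge> 1\<close> the linear term is at most
    \<open>2 * \<bar>\<alpha>\<bar> * k\<close>, so this threshold leaves an exponent of at most
    \<open>- k\<close>, to be compared with a geometric series.\<close>
  have "eventually (\<lambda>k. ln (real k) \<ge> (2 * \<bar>\<alpha>\<bar> + 1) / \<gamma>) sequentially"
    using filterlim_compose[OF ln_at_top filterlim_real_sequentially]
    by (simp add: filterlim_at_top)
  then show "eventually (\<lambda>k. norm (exp (\<alpha> * real (k + 1) - \<gamma> * real k * ln (real k))) \<le> exp (-1) ^ k) sequentially"
    using eventually_ge_at_top[of 1]
  proof eventually_elim
    case (elim k)
    have "2 * \<bar>\<alpha>\<bar> + 1 \<le> \<gamma> * ln (real k)"
      using elim(1) assms by (simp add: field_simps)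
    then have "real k * (2 * \<bar>\<alpha>\<bar> + 1) \<le> real k * (\<gamma> * ln (real k))"
      by (intro mult_left_mono) auto
    moreover have "\<alpha> * real (k + 1) \<le> \<bar>\<alpha>\<bar> * (2 * real k)"
      using elim(2) by (intro mult_mono) auto
    ultimately have "\<alpha> * real (k + 1) - \<gamma> * real k * ln (real k) \<le> real k * (-1)"
      by (simp add: algebra_simps)
    then show ?case by (simp flip: exp_of_nat_mult)
  qed
  show "summable (\<lambda>k. exp (-1 :: real) ^ k)" by (rule summable_geometric) simp
qed

lemma sum_Un_le:
  fixes f :: "'a \<Rightarrow> real"
  assumes "finite A" "finite B" "\<And>a. f a \<ge> 0"
  shows "sum f (A \<union> B) \<le> sum f A + sum f B"
  using sum.union_inter[OF assms(1,2), of f] sum_nonneg[of "A \<inter> B" f] assms(3) by auto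

lemma sum_UN_le:
  fixes f :: "'a \<Rightarrow> real"
  assumes "finite K" "\<And>k. k \<in> K \<Longrightarrow> finite (S k)" "\<And>a. f a \<ge> 0"
  shows "sum f (\<Union>k\<in>K. S k) \<le> (\<Sum>k\<in>K. sum f (S k))"
  using assms(1,2)
proof (induction K rule: finite_induct)
  case (insert k K)
  have "sum f (S k \<union> (\<Union>k\<in>K. S k)) \<le> sum f (S k) + sum f (\<Union>k\<in>K. S k)"
    using insert by (intro sum_Un_le assms(3)) auto
  also have "sum f (\<Union>k\<in>K. S k) \<le> (\<Sum>k\<in>K. sum f (S k))"
    using insert by auto
  finally show ?case using insert by simp
qed auto

theorem theorem1p4:
  fixes m s :: nat
    and A :: "real \<Rightarrow> 'a set"
    and n :: "'a \<Rightarrow> nat"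
    and \<psi> :: "nat \<Rightarrow> real"
  assumes "m \<ge> 1" and "s \<ge> 1"
    and "\<And>x. x > 0 \<Longrightarrow> finite (A x)"
    and "\<And>x y. 0 < x \<Longrightarrow> x \<le> y \<Longrightarrow> A x \<subseteq> A y"
    and "infinite (\<Union>x\<in>{0<..}. A x)"
    and "\<And>a. a \<in> (\<Union>x\<in>{0<..}. A x) \<Longrightarrow> n a \<ge> 1"
    and "\<And>\<delta>. \<delta> \<ge> 1 \<Longrightarrow> \<psi> \<delta> > 0"
    and "\<exists>\<G> :: nat \<Rightarrow> real. (\<forall>\<delta>\<ge>1. \<G> \<delta> > 0) \<and>
           cond_U2_1 m s \<psi> \<and> cond_U2_2 m s \<psi> \<G> \<and> cond_U2_3 m s \<G> \<and> cond_U2_4 \<psi> \<G>"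
    and "cond_U1 A n"
    and "cond_U2 A n \<psi>"
  shows "(\<lambda>x. \<Sum>a\<in>A x. real (divisor_count (n a)) ^ m)
           \<in> O[at_top](\<lambda>x. real (card (A x)) * ln x ^ (s * (2 ^ m - 1)))"
proof -

  \<comment> \<open>Constants extracted from the hypotheses\<close>
  define E where "E = s * (2 ^ m - 1)"
  obtain \<G> :: "nat \<Rightarrow> real" where \<G>: "\<And>\<delta>. \<delta> \<ge> 1 \<Longrightarrow> \<G> \<delta> > 0"
    and cond: "cond_U2_1 m s \<psi>" "cond_U2_2 m s \<psi> \<G>" "cond_U2_3 m s \<G>"
    using assms(8) by auto
  define R where "R x = {k::nat. 1 \<le> k \<and> real k \<le> x}" for x :: real
  define T where "T c x u = {k \<in> smooth_numbers (x powr c) (x powr (1 / u)). x powr (c / 4) \<le> real k}"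
    for c x u :: real
  have finR: "finite (R x)" for x
    by (rule finite_subset[of _ "{..nat \<lfloor>x\<rfloor>}"]) (auto simp: R_def le_nat_floor)
  \<comment> \<open>The implied constants carry no sign; absolute values make them usable as factors
    in monotonicity arguments.\<close>
  have abs_ge: "B \<le> \<bar>C\<bar> * D" if "B \<le> C * D" "D \<ge> 0" for B C D :: real
    using that mult_right_mono[OF abs_ge_self[of C], of D] by linarith
  obtain \<beta> where \<beta>: "\<beta> > 0" "\<And>x a. x > 0 \<Longrightarrow> a \<in> A x \<Longrightarrow> real (n a) < x powr \<beta>"
    using assms(9) unfolding cond_U1_def by blast
  obtain c C0' where c: "0 < c" "c < 1"
    and C0': "\<And>x \<delta>. x > 0 \<Longrightarrow> 1 \<le> \<delta> \<Longrightarrow> real \<delta> \<le> x powr c \<Longrightarrow>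
      real (pi_count A n x \<delta>) \<le> C0' * (1 / \<psi> \<delta>) * real (card (A x))"
    using assms(10) unfolding cond_U2_def by blast
  obtain C1' where C1': "\<And>x. x \<ge> 2 \<Longrightarrow> lcm_sum m (R x) (\<lambda>\<delta>. 1 / \<psi> \<delta>) \<le> C1' * ln x ^ E"
    using cond(1) unfolding cond_U2_1_def R_def E_def by blast
  obtain C2' where C2': "\<And>x. x \<ge> 2 \<Longrightarrow>
      lcm_sum m (R x) (\<lambda>\<delta>. real \<delta> / ((\<psi> \<delta>)\<^sup>2 * \<G> \<delta>)) \<le> C2' * ln x ^ E"
    using cond(2) unfolding cond_U2_2_def R_def E_def by blast
  obtain C3' where C3': "\<And>x u. x \<ge> 3 \<Longrightarrow> 4 / c \<le> u \<Longrightarrow> u < ln x / (2 * ln (ln x)) \<Longrightarrow>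
      lcm_sum m (T c x u) (\<lambda>\<delta>. \<G> \<delta> / real \<delta>) \<le> C3' * ln x ^ E * exp (- (c * u * ln u / 16))"
    using cond(3) c unfolding cond_U2_3_def T_def E_def by meson
  obtain \<eta> C4' where "\<eta> > 0" and C4': "\<And>x u. x \<ge> 3 \<Longrightarrow> u \<ge> ln x / (2 * ln (ln x)) \<Longrightarrow>
      lcm_sum m (T c x u) (\<lambda>\<delta>. \<G> \<delta> / real \<delta>) \<le> C4' * x powr (- \<eta>)"
    using cond(3) c unfolding cond_U2_3_def T_def E_def by meson
  define C0 C1 C2 C3 C4 where "C0 = \<bar>C0'\<bar>" "C1 = \<bar>C1'\<bar>" "C2 = \<bar>C2'\<bar>" "C3 = \<bar>C3'\<bar>" "C4 = \<bar>C4'\<bar>"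
  note C_defs = this
  have C_nonneg: "C0 \<ge> 0" "C1 \<ge> 0" "C2 \<ge> 0" "C3 \<ge> 0" "C4 \<ge> 0"
    by (simp_all add: C_defs)
  \<comment> \<open>Chosen so that \<open>(x powr \<beta>) powr \<epsilon>\<close>, raised to the
    power \<open>m\<close>, is \<open>x powr (\<eta> / 2)\<close>, exactly what the saving for very
    small \<open>q\<close> pays for.\<close>
  define \<epsilon> where "\<epsilon> = \<eta> / (2 * m * \<beta>)"
  have "\<epsilon> > 0" using \<open>\<eta> > 0\<close> \<beta> assms(1) by (simp add: \<epsilon>_def)
  then obtain M where M: "M \<ge> 1" "\<And>D. D \<ge> 1 \<Longrightarrow> real (divisor_count D) \<le> M * real D powr \<epsilon>"
    using divisor_bound by metis
  \<comment> \<open>From \<open>u0\<close> on, integers are admissible values of \<open>u\<close> in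
    (U2-3); also \<open>1 / u0 \<le> c / 2\<close>, so a prime below \<open>x powr (1 / u0)\<close>
    is below \<open>x powr (c / 2)\<close>.\<close>
  define u0 where "u0 = nat \<lceil>4 / c\<rceil>"
  have u0: "4 / c \<le> real u0" "u0 \<ge> 1"
    using c by (auto simp: u0_def real_nat_ceiling_ge Suc_le_eq)
  \<comment> \<open>The cost \<open>2 powr (\<beta> * (k + 1))\<close> of \<open>D\<close>, to the
    power \<open>m\<close>, times the square root of the exponential saving in (U2-3) at
    \<open>u = k\<close>.\<close>
  define h where "h k = exp (real m * \<beta> * ln 2 * real (k + 1) - c / 32 * real k * ln (real k))" for k :: nat
  have "summable h"
    unfolding h_def using c by (intro summable_exp_linear_minus_nlogn) simp
  \<comment> \<open>One summand each for \<open>S1\<close>, for the union of the classes indexed by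
    \<open>k\<close>, and for the class of very small \<open>q\<close>.\<close>
  define K where "K = C0 * (2 powr (\<beta> * u0)) ^ m * C1 + 2 ^ m * C0 * ((C2 + C3) / 2) * suminf h
    + 2 ^ m * C0 * M ^ m * ((C2 + C4) / 2)"

  \<comment> \<open>The hypotheses at a fixed \<open>x\<close>\<close>
  have bound: "(\<Sum>a\<in>A x. real (divisor_count (n a)) ^ m) \<le> K * (card (A x) * ln x ^ E)" if "x > 3" for x
  proof -
    have "x \<ge> 3" using that by simp
    let ?f = "\<lambda>a. real (divisor_count (n a)) ^ m"
    \<comment> \<open>As \<open>exp 1 \<le> 3 < x\<close>; this makes \<open>ln (ln x)\<close>
      positive and \<open>L \<ge> 1\<close>.\<close>
    have lnx: "ln x > 1"
      using exp_le that exp_less_cancel_iff[of 1 "ln x"] by simp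
    define L where "L = ln x ^ E"
    have "L \<ge> 1" using lnx by (simp add: L_def)
    \<comment> \<open>The value of \<open>u\<close> at which (U2-3) changes form;
      \<open>x powr (1 / U)\<close> is \<open>(ln x)\<^sup>2\<close>.\<close>
    define U where "U = ln x / (2 * ln (ln x))"
    have "U > 0" using lnx by (simp add: U_def)
    have finA: "finite (A x)" using assms(3) that by simp
    have n1: "n a \<ge> 1" if "a \<in> A x" for a
      using that \<open>x \<ge> 3\<close> by (intro assms(6) UN_I[of x]) auto
    have T_R: "T c x u \<subseteq> R x" for u
    proof -
      have "x powr c \<le> x powr 1" using c \<open>x \<ge> 3\<close> by (intro powr_mono) auto
      then show ?thesis using \<open>x \<ge> 3\<close> by (auto simp: T_def R_def smooth_numbers_def)
    qed
    have R0: "0 \<notin> R x" by (simp add: R_def)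
    then have T0: "0 \<notin> T c x u" for u using T_R by blast
    have finT: "finite (T c x u)" for u using finR T_R by (rule finite_subset[rotated])
    have U2: "real (card {a\<in>A x. \<delta> dvd n a}) \<le> C0 * (1 / \<psi> \<delta>) * card (A x)"
      if "1 \<le> \<delta>" "real \<delta> \<le> x powr c" for \<delta>
      using abs_ge[of _ C0' "(1 / \<psi> \<delta>) * card (A x)"] C0'[of x \<delta>] that \<open>x \<ge> 3\<close> assms(7)[of \<delta>]
      by (simp add: pi_count_def C_defs)
    have U21: "lcm_sum m (R x) (\<lambda>\<delta>. 1 / \<psi> \<delta>) \<le> C1 * L"
      unfolding C_defs L_def by (rule abs_ge[OF C1']) (use \<open>x \<ge> 3\<close> lnx in auto)
    have U22: "lcm_sum m (T c x u) (\<lambda>\<delta>. real \<delta> / ((\<psi> \<delta>)\<^sup>2 * \<G> \<delta>)) \<le> C2 * L" for u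
    proof -
      have "lcm_sum m (T c x u) (\<lambda>\<delta>. real \<delta> / ((\<psi> \<delta>)\<^sup>2 * \<G> \<delta>))
          \<le> lcm_sum m (R x) (\<lambda>\<delta>. real \<delta> / ((\<psi> \<delta>)\<^sup>2 * \<G> \<delta>))"
        using \<G> by (intro lcm_sum_mono finR T_R R0) (simp add: less_imp_le)
      also have "\<dots> \<le> C2 * L"
        unfolding C_defs L_def by (rule abs_ge[OF C2']) (use \<open>x \<ge> 3\<close> lnx in auto)
      finally show ?thesis .
    qed
    \<comment> \<open>The weight \<open>r\<close> stays free, so that each class can choose the
      value that balances the two terms.\<close>
    have inv_le: "lcm_sum m (T c x u) (\<lambda>\<delta>. 1 / \<psi> \<delta>) \<le> (r * (C2 * L) + G / r) / 2"
      if "r > 0" "lcm_sum m (T c x u) (\<lambda>\<delta>. \<G> \<delta> / real \<delta>) \<le> G" for r u G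
    proof -
      have "lcm_sum m (T c x u) (\<lambda>\<delta>. 1 / \<psi> \<delta>) \<le>
        (r * lcm_sum m (T c x u) (\<lambda>\<delta>. real \<delta> / ((\<psi> \<delta>)\<^sup>2 * \<G> \<delta>))
          + lcm_sum m (T c x u) (\<lambda>\<delta>. \<G> \<delta> / real \<delta>) / r) / 2"
        by (rule lcm_sum_inverse_le) (use that T0 assms(7) \<G> in auto)
      also have "\<dots> \<le> (r * (C2 * L) + G / r) / 2"
        using that U22 by (intro divide_right_mono add_mono mult_left_mono) auto
      finally show ?thesis .
    qed

    \<comment> \<open>Splitting each \<open>n a\<close> as \<open>b a * D a\<close>\<close>
    have "\<forall>a\<in>A x. \<exists>b D. n a = b * D \<and> real b \<le> x powr c \<and>
      (D = 1 \<or> (\<exists>q. prime q \<and> q dvd D \<and> real b * real q > x powr c \<and>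
       (\<forall>p. prime p \<and> p dvd b \<longrightarrow> p \<le> q) \<and> (\<forall>p. prime p \<and> p dvd D \<longrightarrow> q \<le> p)))"
      using n1 \<open>x \<ge> 3\<close> c by (intro ballI prime_prefix_exists) (auto intro: ge_one_powr_ge_zero)
    then obtain b D where nbD: "\<And>a. a \<in> A x \<Longrightarrow> n a = b a * D a"
      and bz: "\<And>a. a \<in> A x \<Longrightarrow> real (b a) \<le> x powr c"
      and split: "\<And>a. a \<in> A x \<Longrightarrow> D a = 1 \<or> (\<exists>q. prime q \<and> q dvd D a \<and> real (b a) * real q > x powr c \<and>
       (\<forall>p. prime p \<and> p dvd b a \<longrightarrow> p \<le> q) \<and> (\<forall>p. prime p \<and> p dvd D a \<longrightarrow> q \<le> p))"
      unfolding bchoice_iff by blast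
    have b1: "b a \<ge> 1" and D1: "D a \<ge> 1" if "a \<in> A x" for a
      using n1[OF that] nbD[OF that] by (auto simp: Suc_le_eq intro: Nat.gr0I)
    have Dx: "real (D a) \<le> x powr \<beta>" if "a \<in> A x" for a
    proof -
      have "D a \<le> n a" using nbD[OF that] b1[OF that] by simp
      then show ?thesis using \<beta>(2)[OF _ that] \<open>x \<ge> 3\<close> by linarith
    qed
    have f_le: "?f a \<le> (real (divisor_count (b a)) * F) ^ m" if "a \<in> A x" "real (divisor_count (D a)) \<le> F" for a F
    proof (rule power_mono)
      have "real (divisor_count (n a)) \<le> real (divisor_count (b a) * divisor_count (D a))"
        unfolding nbD[OF that(1)] of_nat_le_iff using b1 D1 that by (intro divisor_count_mult_le) auto
      also have "\<dots> \<le> real (divisor_count (b a)) * F"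
        using that by (simp add: mult_left_mono)
      finally show "real (divisor_count (n a)) \<le> real (divisor_count (b a)) * F" .
    qed simp
    \<comment> \<open>Since \<open>D a \<le> x powr \<beta>\<close>, it has at most
      \<open>\<beta> * v\<close> prime factors when all of them are at least
      \<open>x powr (1 / v)\<close>.\<close>
    have rough: "real (divisor_count (D a)) \<le> 2 powr (\<beta> * v)"
      if "a \<in> A x" "v > 0" "\<And>p. prime p \<Longrightarrow> p dvd D a \<Longrightarrow> x powr (1 / v) \<le> real p" for a v
    proof -
      have "real (divisor_count (D a)) \<le> 2 powr (ln (D a) / ln (x powr (1 / v)))"
        using that D1 \<open>x \<ge> 3\<close> by (intro divisor_count_le_powr) (auto intro: gr_one_powr)
      also have "ln (real (D a)) \<le> ln (x powr \<beta>)"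
        using Dx[OF that(1)] D1[OF that(1)] by (subst ln_le_cancel_iff) auto
      then have "ln (D a) / ln (x powr (1 / v)) \<le> \<beta> * v"
        using \<open>x \<ge> 3\<close> lnx that(2) by (simp add: ln_powr field_simps)
      then have "2 powr (ln (D a) / ln (x powr (1 / v))) \<le> 2 powr (\<beta> * v)"
        by (intro powr_mono) auto
      finally show ?thesis .
    qed

    \<comment> \<open>The classes and their divisor sums\<close>
    define S1 where "S1 = {a\<in>A x. real (divisor_count (D a)) \<le> 2 powr (\<beta> * u0)}"
    \<comment> \<open>The classes record a bound on the divisor count of \<open>D a\<close> in place
      of \<open>q\<close> itself. They may overlap, as only a covering of \<open>A x\<close> is
      used.\<close>
    define S where "S u F = {a\<in>A x. x powr (c / 2) \<le> real (b a) \<and>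
      (\<forall>p. prime p \<and> p dvd b a \<longrightarrow> real p \<le> x powr (1 / u)) \<and> real (divisor_count (D a)) \<le> F}" for u F :: real
    have finS: "finite S1" "finite (S u F)" for u F
      using finA by (simp_all add: S1_def S_def)

    have sum_S1: "sum ?f S1 \<le> C0 * (2 powr (\<beta> * u0)) ^ m * C1 * (card (A x) * L)"
    proof -
      let ?F = "2 powr (\<beta> * u0)"
      have "sum ?f S1 \<le> (\<Sum>a\<in>S1. ?F ^ m * real (card {t\<in>R x. t dvd b a}) ^ m)"
      proof (rule sum_mono)
        fix a assume "a \<in> S1"
        then have a: "a \<in> A x" "real (divisor_count (D a)) \<le> ?F" by (auto simp: S1_def)
        have "x powr c \<le> x powr 1" using c \<open>x \<ge> 3\<close> by (intro powr_mono) auto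
        then have "real (b a) \<le> x" using bz[OF a(1)] \<open>x \<ge> 3\<close> by simp
        have "t \<in> R x" if "t dvd b a" for t
          using dvd_imp_le[OF that] dvd_pos_nat[OF _ that] b1[OF a(1)] \<open>real (b a) \<le> x\<close>
          by (auto simp: R_def Suc_le_eq)
        then have "{t\<in>R x. t dvd b a} = {t. t dvd b a}" by blast
        then show "?f a \<le> ?F ^ m * real (card {t\<in>R x. t dvd b a}) ^ m"
          using f_le[OF a] by (simp add: divisor_count_def power_mult_distrib mult.commute)
      qed
      also have "\<dots> = ?F ^ m * (\<Sum>a\<in>S1. real (card {t\<in>R x. t dvd b a}) ^ m)"
        by (simp add: sum_distrib_left)
      also have "\<dots> \<le> ?F ^ m * (C0 * card (A x) * lcm_sum m (R x) (\<lambda>\<delta>. 1 / \<psi> \<delta>))"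
        using finA finR R0 C_nonneg assms(7) U2 b1 bz nbD
        by (intro mult_left_mono sum_card_divisors_power_le[where X = "x powr c" and n = n]) (auto simp: S1_def)
      also have "\<dots> \<le> ?F ^ m * (C0 * card (A x) * (C1 * L))"
        using C_nonneg U21 by (intro mult_left_mono) auto
      finally show ?thesis by (simp add: mult_ac)
    qed

    have sum_S: "sum ?f (S u F) \<le> (2 * F) ^ m * (C0 * card (A x) * W)"
      if W: "lcm_sum m (T c x u) (\<lambda>\<delta>. 1 / \<psi> \<delta>) \<le> W" and F: "F \<ge> 0" for u F W
    proof -
      have "sum ?f (S u F) \<le> (\<Sum>a\<in>S u F. (2 * F) ^ m * real (card {t\<in>T c x u. t dvd b a}) ^ m)"
      proof (rule sum_mono)
        fix a assume "a \<in> S u F"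
        then have a: "a \<in> A x" "real (divisor_count (D a)) \<le> F" "x powr (c / 2) \<le> real (b a)"
          "\<And>p. prime p \<Longrightarrow> p dvd b a \<Longrightarrow> real p \<le> x powr (1 / u)"
          by (auto simp: S_def)
        \<comment> \<open>Divisors of \<open>b a\<close> above its square root are at least
          \<open>x powr (c / 4)\<close>, which puts them in the range of (U2-3).\<close>
        have "x powr (c / 4) = sqrt (x powr (c / 2))"
          using \<open>x \<ge> 3\<close> by (simp add: powr_half_sqrt[symmetric] powr_powr)
        also have "\<dots> \<le> sqrt (b a)" using a(3) by simp
        finally have large: "x powr (c / 4) \<le> sqrt (b a)" .
        have "t \<in> T c x u" if "t dvd b a" "sqrt (b a) \<le> t" for t
          using dvd_imp_le[OF that(1)] dvd_pos_nat[OF _ that(1)] b1[OF a(1)] bz[OF a(1)] large that a(4)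
          by (auto simp: T_def smooth_numbers_def Suc_le_eq intro: dvd_trans)
        then have "card {t. t dvd b a \<and> sqrt (b a) \<le> t} \<le> card {t\<in>T c x u. t dvd b a}"
          using finT by (intro card_mono) auto
        then have "divisor_count (b a) \<le> 2 * card {t\<in>T c x u. t dvd b a}"
          using divisor_count_le_twice_large[OF b1[OF a(1)]] by linarith
        then have "real (divisor_count (b a)) \<le> 2 * real (card {t\<in>T c x u. t dvd b a})"
          by linarith
        then have "(real (divisor_count (b a)) * F) ^ m \<le> (2 * real (card {t\<in>T c x u. t dvd b a}) * F) ^ m"
          using F by (intro power_mono mult_right_mono) auto
        with f_le[OF a(1,2)] show "?f a \<le> (2 * F) ^ m * real (card {t\<in>T c x u. t dvd b a}) ^ m"
          by (simp add: power_mult_distrib mult_ac)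
      qed
      also have "\<dots> = (2 * F) ^ m * (\<Sum>a\<in>S u F. real (card {t\<in>T c x u. t dvd b a}) ^ m)"
        by (simp add: sum_distrib_left)
      also have "\<dots> \<le> (2 * F) ^ m * (C0 * card (A x) * lcm_sum m (T c x u) (\<lambda>\<delta>. 1 / \<psi> \<delta>))"
        using finA finT T0 C_nonneg assms(7) U2 b1 bz nbD F
        by (intro mult_left_mono sum_card_divisors_power_le[where X = "x powr c" and n = n]) (auto simp: S_def)
      also have "\<dots> \<le> (2 * F) ^ m * (C0 * card (A x) * W)"
        using C_nonneg W F by (intro mult_left_mono) auto
      finally show ?thesis .
    qed

    define F2 where "F2 k = 2 powr (\<beta> * real (k + 1))" for k :: nat
    have sum_S2: "sum ?f (S (real k) (F2 k)) \<le> 2 ^ m * C0 * ((C2 + C3) / 2) * (card (A x) * L) * h k"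
      if k: "u0 \<le> k" "real k < U" for k
    proof -
      \<comment> \<open>The square root of the saving in (U2-3): both terms of \<open>inv_le\<close>
        become multiples of \<open>L * r\<close>. This is how 16 turns into 32.\<close>
      define r where "r = exp (- (c / 32 * real k * ln (real k)))"
      have r2: "r * r = exp (- (c * real k * ln (real k) / 16))"
        by (simp add: r_def flip: exp_add)
      have "4 / c \<le> real k" using k u0 by linarith
      then have "lcm_sum m (T c x k) (\<lambda>\<delta>. \<G> \<delta> / real \<delta>) \<le> C3' * (L * exp (- (c * real k * ln (real k) / 16)))"
        using C3'[of x k] \<open>x \<ge> 3\<close> k(2) by (simp add: U_def L_def mult.assoc)
      then have "lcm_sum m (T c x k) (\<lambda>\<delta>. \<G> \<delta> / real \<delta>) \<le> C3 * (L * exp (- (c * real k * ln (real k) / 16)))"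
        unfolding C_defs by (rule abs_ge) (use \<open>L \<ge> 1\<close> in auto)
      then have "lcm_sum m (T c x k) (\<lambda>\<delta>. \<G> \<delta> / real \<delta>) \<le> C3 * L * (r * r)"
        unfolding r2 by (simp add: mult_ac)
      then have "lcm_sum m (T c x k) (\<lambda>\<delta>. 1 / \<psi> \<delta>) \<le> (r * (C2 * L) + C3 * L * (r * r) / r) / 2"
        by (rule inv_le[rotated]) (simp add: r_def)
      also have "\<dots> = (C2 + C3) / 2 * L * r"
        by (simp add: r_def field_simps)
      finally have "sum ?f (S k (F2 k)) \<le> (2 * F2 k) ^ m * (C0 * card (A x) * ((C2 + C3) / 2 * L * r))"
        by (rule sum_S) (simp add: F2_def)
      also have "(2 * F2 k) ^ m = 2 ^ m * exp (real m * \<beta> * ln 2 * real (k + 1))"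
        by (simp add: F2_def power_mult_distrib powr_def mult_ac flip: exp_of_nat_mult)
      also have "2 ^ m * exp (real m * \<beta> * ln 2 * real (k + 1)) * (C0 * card (A x) * ((C2 + C3) / 2 * L * r))
          = 2 ^ m * C0 * ((C2 + C3) / 2) * (card (A x) * L) * (exp (real m * \<beta> * ln 2 * real (k + 1)) * r)"
        by (simp only: mult_ac)
      also have "exp (real m * \<beta> * ln 2 * real (k + 1)) * r = h k"
        by (simp add: h_def r_def flip: exp_add)
      finally show ?thesis .
    qed

    \<comment> \<open>For very small \<open>q\<close> the number of prime factors of
      \<open>D a\<close> can grow with \<open>x\<close>, so the general divisor bound takes
      over.\<close>
    define F3 where "F3 = M * (x powr \<beta>) powr \<epsilon>"
    have F3: "real (divisor_count (D a)) \<le> F3" if "a \<in> A x" for a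
    proof -
      have "real (divisor_count (D a)) \<le> M * real (D a) powr \<epsilon>" using M(2) D1[OF that] by blast
      also have "\<dots> \<le> F3"
        unfolding F3_def using M(1) Dx[OF that] \<open>\<epsilon> > 0\<close> by (intro mult_left_mono powr_mono2) auto
      finally show ?thesis .
    qed
    have sum_S3: "sum ?f (S U F3) \<le> 2 ^ m * C0 * M ^ m * ((C2 + C4) / 2) * (card (A x) * L)"
    proof -
      \<comment> \<open>Again the square root of the saving, now
        \<open>x powr (- \<eta>)\<close>.\<close>
      define r where "r = x powr (- (\<eta> / 2))"
      have "r > 0" using \<open>x \<ge> 3\<close> by (simp add: r_def)
      have r2: "r * r = x powr (- \<eta>)"
        by (simp add: r_def flip: powr_add)
      have "lcm_sum m (T c x U) (\<lambda>\<delta>. \<G> \<delta> / real \<delta>) \<le> C4' * (r * r)"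
        using C4'[of x U] \<open>x \<ge> 3\<close> by (simp add: U_def r2)
      then have "lcm_sum m (T c x U) (\<lambda>\<delta>. \<G> \<delta> / real \<delta>) \<le> C4 * (r * r)"
        unfolding C_defs by (rule abs_ge) simp
      then have "lcm_sum m (T c x U) (\<lambda>\<delta>. 1 / \<psi> \<delta>) \<le> (r * (C2 * L) + C4 * (r * r) / r) / 2"
        by (rule inv_le[OF \<open>r > 0\<close>])
      also have "\<dots> = r * (C2 * L + C4 * 1) / 2"
        using \<open>r > 0\<close> by (simp add: field_simps)
      \<comment> \<open>The second bound of (U2-3) has no power of the logarithm;
        \<open>L \<ge> 1\<close> supplies it.\<close>
      also have "\<dots> \<le> r * (C2 * L + C4 * L) / 2"
        using \<open>r > 0\<close> \<open>L \<ge> 1\<close> C_nonneg by (intro divide_right_mono mult_left_mono add_left_mono) auto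
      finally have "sum ?f (S U F3) \<le> (2 * F3) ^ m * (C0 * card (A x) * (r * (C2 * L + C4 * L) / 2))"
        by (rule sum_S) (use M in \<open>simp add: F3_def\<close>)
      also have "(2 * F3) ^ m = 2 ^ m * M ^ m * x powr (\<beta> * \<epsilon> * m)"
        using \<open>x \<ge> 3\<close> by (simp add: F3_def power_mult_distrib powr_powr powr_power mult_ac)
      also have "\<beta> * \<epsilon> * m = \<eta> / 2"
        using \<beta> assms(1) by (simp add: \<epsilon>_def)
      also have "2 ^ m * M ^ m * x powr (\<eta> / 2) * (C0 * card (A x) * (r * (C2 * L + C4 * L) / 2))
          = 2 ^ m * C0 * M ^ m * ((C2 + C4) / 2) * (card (A x) * L) * (x powr (\<eta> / 2) * r)"
        by (simp add: algebra_simps)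
      also have "x powr (\<eta> / 2) * r = 1"
        using \<open>x \<ge> 3\<close> by (simp add: r_def flip: powr_add)
      finally show ?thesis by simp
    qed

    \<comment> \<open>The classes cover \<open>A x\<close>\<close>
    define KK where "KK = {k::nat. u0 \<le> k \<and> real k < U}"
    have "KK \<subseteq> {..nat \<lfloor>U\<rfloor>}" by (auto simp: KK_def le_nat_floor)
    then have finKK: "finite KK" using finite_subset by blast
    have cover: "A x \<subseteq> S1 \<union> (\<Union>k\<in>KK. S (real k) (F2 k)) \<union> S U F3"
    proof
      fix a assume a: "a \<in> A x"
      show "a \<in> S1 \<union> (\<Union>k\<in>KK. S (real k) (F2 k)) \<union> S U F3"
      proof (cases "D a = 1")
        case True
        then have "a \<in> S1" using a \<beta> by (auto simp: S1_def intro!: ge_one_powr_ge_zero)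
        then show ?thesis by blast
      next
        case False
        then obtain q where q: "prime q" "q dvd D a" "real (b a) * real q > x powr c"
          "\<And>p. prime p \<Longrightarrow> p dvd b a \<Longrightarrow> p \<le> q" "\<And>p. prime p \<Longrightarrow> p dvd D a \<Longrightarrow> q \<le> p"
          using split[OF a] by blast
        have "q \<ge> 2" using q(1) by (rule prime_ge_2_nat)
        then have "ln (real q) > 0" by simp
        show ?thesis
        proof (cases "x powr (1 / u0) \<le> real q")
          case True
          then have "a \<in> S1"
            unfolding S1_def using a u0 by (auto intro!: rough dest: q(5) intro: order_trans)
          then show ?thesis by blast
        next
          case False
          \<comment> \<open>The integer with
            \<open>x powr (1 / (k + 1)) < q \<le> x powr (1 / k)\<close>: the lower bound controls
            \<open>D a\<close>, the upper one the smoothness of \<open>b a\<close>.\<close>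
          define k where "k = nat \<lfloor>ln x / ln q\<rfloor>"
          have "ln q < ln (x powr (1 / u0))"
            using False \<open>q \<ge> 2\<close> \<open>x \<ge> 3\<close> by (subst ln_less_cancel_iff) auto
          then have "real u0 \<le> ln x / ln q"
            using \<open>x \<ge> 3\<close> u0 \<open>ln q > 0\<close> by (simp add: ln_powr field_simps)
          then have "u0 \<le> k" by (simp add: k_def le_nat_floor)
          then have "k \<ge> 1" using u0 by simp
          have "real k \<le> ln x / ln q"
            unfolding k_def using lnx \<open>ln q > 0\<close> by (intro of_nat_floor) auto
          then have "ln q \<le> ln (x powr (1 / k))"
            using \<open>x \<ge> 3\<close> \<open>k \<ge> 1\<close> \<open>ln q > 0\<close> by (simp add: ln_powr field_simps)
          then have qk: "real q \<le> x powr (1 / k)"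
            using \<open>q \<ge> 2\<close> \<open>x \<ge> 3\<close> by (subst (asm) ln_le_cancel_iff) auto
          have "ln x / ln q < real (k + 1)"
            unfolding k_def by linarith
          then have "ln (x powr (1 / real (k + 1))) \<le> ln q"
            using \<open>x \<ge> 3\<close> \<open>ln q > 0\<close> by (simp add: ln_powr field_simps)
          then have kq: "x powr (1 / real (k + 1)) \<le> real q"
            using \<open>q \<ge> 2\<close> \<open>x \<ge> 3\<close> by (subst (asm) ln_le_cancel_iff) auto
          \<comment> \<open>As \<open>b a * q > x powr c\<close> and \<open>q\<close> is at most
            \<open>x powr (c / 2)\<close>, the prefix \<open>b a\<close> must be at least
            \<open>x powr (c / 2)\<close>.\<close>
          have "1 / real u0 \<le> c / 2"
            using u0 c by (simp add: field_simps)
          then have "x powr (1 / u0) \<le> x powr (c / 2)"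
            using \<open>x \<ge> 3\<close> by (intro powr_mono) auto
          then have "real q \<le> x powr (c / 2)" using False by linarith
          then have "real (b a) * real q \<le> real (b a) * x powr (c / 2)"
            by (intro mult_left_mono) auto
          then have "x powr (c / 2) * x powr (c / 2) < real (b a) * x powr (c / 2)"
            using q(3) by (simp flip: powr_add)
          then have bl: "x powr (c / 2) \<le> real (b a)"
            using \<open>x \<ge> 3\<close> by simp
          show ?thesis
          proof (cases "real k < U")
            case True
            have "real (divisor_count (D a)) \<le> F2 k"
              unfolding F2_def using kq q(5) by (intro rough a) (auto intro: order_trans)
            moreover have "real p \<le> x powr (1 / k)" if "prime p" "p dvd b a" for p
              using q(4)[OF that] qk by linarith
            ultimately have "a \<in> S (real k) (F2 k)"
              using a bl by (auto simp: S_def)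
            then show ?thesis using True \<open>u0 \<le> k\<close> by (auto simp: KK_def)
          next
            case False
            \<comment> \<open>For all \<open>k \<ge> U\<close> the smoothness bound is relaxed to
              the single value \<open>U\<close>, where the second half of (U2-3) already
              applies.\<close>
            then have "x powr (1 / k) \<le> x powr (1 / U)"
              using \<open>x \<ge> 3\<close> \<open>U > 0\<close> by (intro powr_mono) (auto simp: frac_le)
            then have "real p \<le> x powr (1 / U)" if "prime p" "p dvd b a" for p
              using q(4)[OF that] qk by linarith
            then have "a \<in> S U F3"
              using a bl F3 by (auto simp: S_def)
            then show ?thesis by blast
          qed
        qed
      qed
    qed

    \<comment> \<open>Adding up the classes\<close>
    have "sum ?f (A x) \<le> sum ?f (S1 \<union> (\<Union>k\<in>KK. S (real k) (F2 k)) \<union> S U F3)"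
      using finS finKK by (intro sum_mono2 cover) auto
    also have "\<dots> \<le> sum ?f (S1 \<union> (\<Union>k\<in>KK. S (real k) (F2 k))) + sum ?f (S U F3)"
      using finS finKK by (intro sum_Un_le) auto
    also have "sum ?f (S1 \<union> (\<Union>k\<in>KK. S (real k) (F2 k))) \<le> sum ?f S1 + sum ?f (\<Union>k\<in>KK. S (real k) (F2 k))"
      using finS finKK by (intro sum_Un_le) auto
    also have "sum ?f (\<Union>k\<in>KK. S (real k) (F2 k)) \<le> (\<Sum>k\<in>KK. sum ?f (S (real k) (F2 k)))"
      using finS finKK by (intro sum_UN_le) auto
    also have "\<dots> \<le> (\<Sum>k\<in>KK. 2 ^ m * C0 * ((C2 + C3) / 2) * (card (A x) * L) * h k)"
      by (intro sum_mono sum_S2) (auto simp: KK_def)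
    also have "\<dots> = 2 ^ m * C0 * ((C2 + C3) / 2) * (card (A x) * L) * sum h KK"
      by (simp add: sum_distrib_left)
    \<comment> \<open>The index set \<open>KK\<close> depends on \<open>x\<close>; the full series
      bounds the sum uniformly.\<close>
    also have "\<dots> \<le> 2 ^ m * C0 * ((C2 + C3) / 2) * (card (A x) * L) * suminf h"
      using \<open>summable h\<close> finKK C_nonneg \<open>L \<ge> 1\<close>
      by (intro mult_left_mono sum_le_suminf mult_nonneg_nonneg) (auto simp: h_def)
    finally have "sum ?f (A x) \<le> C0 * (2 powr (\<beta> * u0)) ^ m * C1 * (card (A x) * L)
        + 2 ^ m * C0 * ((C2 + C3) / 2) * (card (A x) * L) * suminf h
        + 2 ^ m * C0 * M ^ m * ((C2 + C4) / 2) * (card (A x) * L)"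
      using sum_S1 sum_S3 by simp
    also have "\<dots> = K * (card (A x) * L)"
      unfolding K_def distrib_right by (simp only: mult_ac)
    finally show ?thesis by (simp add: L_def)
  qed
  have "eventually (\<lambda>x. norm (\<Sum>a\<in>A x. real (divisor_count (n a)) ^ m)
      \<le> K * norm (real (card (A x)) * ln x ^ E)) at_top"
    using eventually_gt_at_top[of 3]
  proof eventually_elim
    case (elim x)
    have "0 \<le> real (card (A x)) * ln x ^ E" using elim by simp
    then show ?case using bound[OF elim] by (simp add: sum_nonneg)
  qed
  then show ?thesis
    unfolding E_def by (rule bigoI)
qed

end
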